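(* Let $n\ge 2$ be an integer and let $\mathbf c_1,\dots,\mathbf c_{n-1},\mathbf b_1,\dots,\mathbf b_{n-1},\mathbf d\in\mathbb H$. Write $\mathbf b_p=b_{p0}+b_{p1}\mathbf i+b_{p2}\mathbf j+b_{p3}\mathbf k$ with $b_{pi}\in\mathbb R$, put $\mathbf a_i:=\sum_{p=1}^{n-1}b_{pi}\mathbf c_p$ for $i=0,1,2,3$, and let $\mathbf A=(\mathbf a_0\,|\,1)+(\mathbf a_1\,|\,\mathbf i)+(\mathbf a_2\,|\,\mathbf j)+(\mathbf a_3\,|\,\mathbf k)$, regarded as a real $4\times4$ matrix, so that the equation $\sum_{p=1}^{n-1}\mathbf c_p\mathbf q\mathbf b_p=\mathbf d$ in the unknown $\mathbf q\in\mathbb H$ reads $\mathbf A\mathbf q=\mathbf d$. Then $$\det(\mathbf A)=2\sum_{p,q,r,s=1}^{n-1}(\acute{\mathbf c}_p\cdot\acute{\mathbf c}_q)(\acute{\mathbf c}_r\cdot\acute{\mathbf c}_s)(\acute{\mathbf b}_p\cdot\acute{\mathbf b}_r)(\acute{\mathbf b}_q\cdot\acute{\mathbf b}_s)-\Big(\sum_{p,q=1}^{n-1}(\acute{\mathbf c}_p\cdot\acute{\mathbf c}_q)(\acute{\mathbf b}_p\cdot\acute{\mathbf b}_q)\Big)^2-\frac13\sum_{p,q,r,s=1}^{n-1}[\acute{\mathbf c}_p\acute{\mathbf c}_q\acute{\mathbf c}_r\acute{\mathbf c}_s]\,[\acute{\mathbf b}_p\acute{\mathbf b}_q\acute{\mathbf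 b}_r\acute{\mathbf b}_s].$$ The solution $\mathbf q$ of $\sum_{p=1}^{n-1}\mathbf c_p\mathbf q\mathbf b_p=\mathbf d$ is unique if and only if $\det(\mathbf A)\neq0$, and when $\det(\mathbf A)\ne 0$ the solution is $$\mathbf q=\frac{-1}{3\det(\mathbf A)}\sum_{p,q,r=1}^{n-1}\Big\{\overline{\mathbf c}_{pqr}^{\sim}\,\mathbf d\,\overline{\mathbf b}_{pqr}^{\sim}+3(\acute{\mathbf c}_p\cdot\acute{\mathbf c}_q)\Big((\acute{\mathbf b}_p\cdot\acute{\mathbf b}_q)\,\overline{\mathbf c}_r\mathbf d\overline{\mathbf b}_r-2(\acute{\mathbf b}_p\cdot\acute{\mathbf b}_r)\,\overline{\mathbf c}_r\mathbf d\overline{\mathbf b}_q\Big)\Big\}.$$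
   Context: $\mathbb H$ is the algebra of real quaternions with basis $1,\mathbf i,\mathbf j,\mathbf k$; the over-bar is quaternionic conjugation. For $\mathbf u,\mathbf v\in\mathbb H$, $(\mathbf u\,|\,\mathbf v)$ is the real-linear operator on $\mathbb H$ given by $(\mathbf u\,|\,\mathbf v)\mathbf q=\mathbf u\mathbf q\mathbf v$; operators on $\mathbb H$ are identified with their $4\times 4$ real matrices in the basis $1,\mathbf i,\mathbf j,\mathbf k$. Let $\mathbf e_0,\mathbf e_1,\mathbf e_2,\mathbf e_3$ be an orthonormal basis of Euclidean $\mathbb R^4$ (inner product denoted by a dot), and $\mathbf f:\mathbb H\to\mathbb R^4$ the linear isomorphism $1\mapsto\mathbf e_0$, $\mathbf i\mapsto\mathbf e_1$, $\mathbf j\mapsto\mathbf e_2$, $\mathbf k\mapsto\mathbf e_3$. Write $\acute{\mathbf a}:=\mathbf f(\mathbf a)$. $CL(\mathbb R^4)$ is the Clifford algebra with $\mathbf x\mathbf x=\mathbf x\cdot\mathbf x$ for $\mathbf x\in\mathbb R^4$; $\wedge$ is the outer (exterior) product in it; $\mathbf I_4:=\mathbf e_0\mathbf e_1\mathbf e_2\mathbf e_3$; the dual of $X$ is $X^\sim:=X\mathbf I_4$. The bracket is $[\mathbf x_1\mathbf x_2\mathbf x_3\mathbf x_4]:=(\mathbf x_1\wedge\mathbf x_2\wedge\mathbf x_3\wedge\mathbf x_4)^\sim\in\mathbb R$, i.e. the determinant of the $4\times4$ matrix whose rows are the coordinates of $\mathbf x_1,\dots,\mathbf x_4$ in $\mathbf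 e_0,\dots,\mathbf e_3$. For quaternions $\mathbf a_p,\mathbf a_q,\mathbf a_r$ of an indexed family, $\overline{\mathbf a}_{pqr}^{\sim}:=\mathbf f^{-1}\big((\mathbf f(\overline{\mathbf a_p})\wedge\mathbf f(\overline{\mathbf a_q})\wedge\mathbf f(\overline{\mathbf a_r}))^\sim\big)\in\mathbb H$ (the dual of a trivector in $CL(\mathbb R^4)$ is a vector). *)

theory Defs
  imports "HOL-Analysis.Analysis"
begin

section \<open>Real quaternions\<close>

datatype quat = Quat (qre: real) (qim1: real) (qim2: real) (qim3: real)

lemma quat_eq_iff:
  "x = y \<longleftrightarrow> qre x = qre y \<and> qim1 x = qim1 y \<and> qim2 x = qim2 y \<and> qim3 x = qim3 y"
  by (cases x; cases y) simp

instantiation quat :: real_algebra_1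
begin

definition zero_quat :: quat where "0 = Quat 0 0 0 0"

definition one_quat :: quat where "1 = Quat 1 0 0 0"

definition plus_quat :: "quat \<Rightarrow> quat \<Rightarrow> quat" where
  "x + y = Quat (qre x + qre y) (qim1 x + qim1 y) (qim2 x + qim2 y) (qim3 x + qim3 y)"

definition uminus_quat :: "quat \<Rightarrow> quat" where
  "- x = Quat (- qre x) (- qim1 x) (- qim2 x) (- qim3 x)"

definition minus_quat :: "quat \<Rightarrow> quat \<Rightarrow> quat" where
  "x - y = Quat (qre x - qre y) (qim1 x - qim1 y) (qim2 x - qim2 y) (qim3 x - qim3 y)"

definition scaleR_quat :: "real \<Rightarrow> quat \<Rightarrow> quat" where
  "r *\<^sub>R x = Quat (r * qre x) (r * qim1 x) (r * qim2 x) (r * qim3 x)"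

definition times_quat :: "quat \<Rightarrow> quat \<Rightarrow> quat" where
  "x * y = Quat
     (qre x * qre y - qim1 x * qim1 y - qim2 x * qim2 y - qim3 x * qim3 y)
     (qre x * qim1 y + qim1 x * qre y + qim2 x * qim3 y - qim3 x * qim2 y)
     (qre x * qim2 y - qim1 x * qim3 y + qim2 x * qre y + qim3 x * qim1 y)
     (qre x * qim3 y + qim1 x * qim2 y - qim2 x * qim1 y + qim3 x * qre y)"

instance
  by standard
    (simp_all add: quat_eq_iff zero_quat_def one_quat_def plus_quat_def uminus_quat_def
       minus_quat_def scaleR_quat_def times_quat_def algebra_simps)

end

definition qii :: quat where "qii = Quat 0 1 0 0"
definition qjj :: quat where "qjj = Quat 0 0 1 0"
definition qkk :: quat where "qkk = Quat 0 0 0 1"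

lemma quat_unit_products:
  "qii * qii = -1" "qjj * qjj = -1" "qkk * qkk = -1"
  "qii * qjj = qkk" "qjj * qkk = qii" "qkk * qii = qjj"
  "qjj * qii = - qkk" "qkk * qjj = - qii" "qii * qkk = - qjj"
  by (simp_all add: quat_eq_iff qii_def qjj_def qkk_def times_quat_def uminus_quat_def one_quat_def)

definition qcnj :: "quat \<Rightarrow> quat" where
  "qcnj q = Quat (qre q) (- qim1 q) (- qim2 q) (- qim3 q)"

text \<open>
  The index type \<^typ>\<open>4\<close> has the elements \<open>0, 1, 2, 3\<close> (with \<open>4 = 0\<close>), in this order; it indexes the
  basis \<open>1, i, j, k\<close> of the quaternions and the orthonormal basis of \<open>real ^ 4\<close> below.
\<close>

definition qbasis :: "4 \<Rightarrow> quat" where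
  "qbasis i = (if i = 0 then 1 else if i = 1 then qii else if i = 2 then qjj else qkk)"

definition qcoord :: "quat \<Rightarrow> real ^ 4" where
  "qcoord q = (\<chi> i. if i = 0 then qre q else if i = 1 then qim1 q else if i = 2 then qim2 q else qim3 q)"

lemma quat_expansion: "q = (\<Sum>i\<in>UNIV. qcoord q $ i *\<^sub>R qbasis i)"
proof -
  have 4: "(4::4) = 0" by simp
  show ?thesis
    unfolding sum_4 4
    by (simp add: qcoord_def qbasis_def quat_eq_iff plus_quat_def scaleR_quat_def one_quat_def
        qii_def qjj_def qkk_def)
qed

text \<open>\<open>qop u v\<close> is the operator \<open>(u | v)\<close>.\<close>

definition qop :: "quat \<Rightarrow> quat \<Rightarrow> quat \<Rightarrow> quat" where
  "qop u v q = u * q * v"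

definition qmatrix :: "(quat \<Rightarrow> quat) \<Rightarrow> real ^ 4 ^ 4" where
  "qmatrix L = (\<chi> i j. qcoord (L (qbasis j)) $ i)"

section \<open>The Clifford algebra of Euclidean space\<close>

text \<open>
  A multivector is given by its coefficients with respect to the basis of blades: for a set
  \<open>A = {i\<^sub>1 < \<dots> < i\<^sub>k}\<close> of indices, the blade of \<open>A\<close> is the product of the standard unit vectors
  with indices \<open>i\<^sub>1, \<dots>, i\<^sub>k\<close>.  The signature is positive, so the product of the blades of \<open>A\<close> and
  \<open>B\<close> is the blade of \<open>sym_diff A B\<close>, with one sign change for every pair \<open>i \<in> A\<close>, \<open>j \<in> B\<close> with
  \<open>j < i\<close>.
\<close>

typedef 'n clifford = "UNIV :: ('n set \<Rightarrow> real) set"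
  morphisms blade_coeff Clifford ..

setup_lifting type_definition_clifford

lemma clifford_eq_iff: "x = y \<longleftrightarrow> (\<forall>S. blade_coeff x S = blade_coeff y S)"
  by (metis blade_coeff_inject ext)

definition blade_sign :: "('n::{finite,linorder}) set \<Rightarrow> 'n set \<Rightarrow> real" where
  "blade_sign A B = (\<Prod>i\<in>A. \<Prod>j\<in>B. if j < i then -1 else 1)"

lemma prod_sym_diff:
  fixes f :: "'n::finite \<Rightarrow> real"
  assumes "\<And>i. f i * f i = 1"
  shows "prod f (sym_diff A B) = prod f A * prod f B"
proof -
  have sq: "prod f X * prod f X = 1" for X
    by (simp add: assms flip: prod.distrib)
  have 1: "prod f (sym_diff A B) = prod f (A - B) * prod f (B - A)"
    by (rule prod.union_disjoint) auto
  have 2: "prod f A = prod f (A - B) * prod f (A \<inter> B)"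
    by (subst prod.union_disjoint[symmetric]) (auto intro: arg_cong[where f = "prod f"])
  have 3: "prod f B = prod f (B - A) * prod f (A \<inter> B)"
    by (subst prod.union_disjoint[symmetric]) (auto intro: arg_cong[where f = "prod f"])
  show ?thesis
    unfolding 1 2 3 using sq[of "A \<inter> B"] by (simp add: mult.assoc mult.left_commute)
qed

lemma blade_sign_sq: "blade_sign A B * blade_sign A B = 1"
  unfolding blade_sign_def by (simp add: if_distrib cong: if_cong flip: prod.distrib)

lemma blade_sign_left: "blade_sign (sym_diff A B) C = blade_sign A C * blade_sign B C"
  unfolding blade_sign_def
  by (rule prod_sym_diff) (simp add: if_distrib cong: if_cong flip: prod.distrib)

lemma blade_sign_right: "blade_sign A (sym_diff B C) = blade_sign A B * blade_sign A C"
  unfolding blade_sign_def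
  by (subst prod_sym_diff) (simp_all add: prod.distrib)

lemma blade_sign_empty [simp]: "blade_sign {} B = 1" "blade_sign A {} = 1"
  by (simp_all add: blade_sign_def)

instantiation clifford :: ("{finite,linorder}") real_algebra_1
begin

lift_definition zero_clifford :: "'a clifford" is "\<lambda>S. 0" .

lift_definition one_clifford :: "'a clifford" is "\<lambda>S. if S = {} then 1 else 0" .

lift_definition plus_clifford :: "'a clifford \<Rightarrow> 'a clifford \<Rightarrow> 'a clifford"
  is "\<lambda>x y S. x S + y S" .

lift_definition uminus_clifford :: "'a clifford \<Rightarrow> 'a clifford" is "\<lambda>x S. - x S" .

lift_definition minus_clifford :: "'a clifford \<Rightarrow> 'a clifford \<Rightarrow> 'a clifford"
  is "\<lambda>x y S. x S - y S" .

lift_definition scaleR_clifford :: "real \<Rightarrow> 'a clifford \<Rightarrow> 'a clifford"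
  is "\<lambda>r x S. r * x S" .

text \<open>\<open>sym_diff A S\<close> is the unique \<open>B\<close> with \<open>sym_diff A B = S\<close>.\<close>

lift_definition times_clifford :: "'a clifford \<Rightarrow> 'a clifford \<Rightarrow> 'a clifford"
  is "\<lambda>x y S. \<Sum>A\<in>UNIV. blade_sign A (sym_diff A S) * x A * y (sym_diff A S)" .

instance
proof
  fix x y z :: "'a clifford" and r s :: real
  show "x + y + z = x + (y + z)" by transfer (simp add: algebra_simps)
  show "x + y = y + x" by transfer (simp add: algebra_simps)
  show "0 + x = x" by transfer simp
  show "- x + x = 0" by transfer simp
  show "x - y = x + - y" by transfer simp
  show "r *\<^sub>R (x + y) = r *\<^sub>R x + r *\<^sub>R y" by transfer (simp add: algebra_simps)
  show "(r + s) *\<^sub>R x = r *\<^sub>R x + s *\<^sub>R x" by transfer (simp add: algebra_simps)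
  show "r *\<^sub>R s *\<^sub>R x = (r * s) *\<^sub>R x" by transfer (simp add: algebra_simps)
  show "1 *\<^sub>R x = x" by transfer simp
  show "(x + y) * z = x * z + y * z"
    by transfer (simp add: algebra_simps sum.distrib)
  show "x * (y + z) = x * y + x * z"
    by transfer (simp add: algebra_simps sum.distrib)
  show "r *\<^sub>R x * y = r *\<^sub>R (x * y)"
    by transfer (simp add: algebra_simps sum_distrib_left)
  show "x * r *\<^sub>R y = r *\<^sub>R (x * y)"
    by transfer (simp add: algebra_simps sum_distrib_left)
  show "(0::'a clifford) \<noteq> 1"
    by transfer (auto simp: fun_eq_iff)
  show "1 * x = x"
  proof (transfer, rule ext)
    fix x :: "'a set \<Rightarrow> real" and S
    have "(\<Sum>A\<in>UNIV. blade_sign A (sym_diff A S) * (if A = {} then 1 else 0) * x (sym_diff A S))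
        = (\<Sum>A\<in>(UNIV :: 'a set set). if A = {} then x S else 0)"
      by (rule sum.cong) auto
    then show "(\<Sum>A\<in>UNIV. blade_sign A (sym_diff A S) * (if A = {} then 1 else 0) * x (sym_diff A S)) = x S"
      by simp
  qed
  show "x * 1 = x"
  proof (transfer, rule ext)
    fix x :: "'a set \<Rightarrow> real" and S
    have "(\<Sum>A\<in>UNIV. blade_sign A (sym_diff A S) * x A * (if sym_diff A S = {} then 1 else 0))
        = (\<Sum>A\<in>UNIV. if A = S then x S else 0)"
      by (rule sum.cong) auto
    then show "(\<Sum>A\<in>UNIV. blade_sign A (sym_diff A S) * x A * (if sym_diff A S = {} then 1 else 0)) = x S"
      by simp
  qed
  show "x * y * z = x * (y * z)"
  proof (transfer, rule ext)
    fix x y z :: "'a set \<Rightarrow> real" and S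
    let ?l = "\<lambda>T A. blade_sign T (sym_diff T S) * (blade_sign A (sym_diff A T) * x A * y (sym_diff A T))
                * z (sym_diff T S)"
    let ?r = "\<lambda>A B. blade_sign A (sym_diff A S) * x A *
                (blade_sign B (sym_diff B (sym_diff A S)) * y B * z (sym_diff B (sym_diff A S)))"
    have eq: "?l T A = ?r A (sym_diff A T)" for T A
    proof -
      let ?B = "sym_diff A T" and ?C = "sym_diff T S"
      have e: "sym_diff A S = sym_diff ?B ?C" "sym_diff ?B (sym_diff A S) = ?C"
        "T = sym_diff A ?B" by auto
      have "blade_sign T ?C = blade_sign A ?C * blade_sign ?B ?C"
        by (subst (1) e(3), subst blade_sign_left) (rule refl)
      moreover have "blade_sign A (sym_diff A S) = blade_sign A ?B * blade_sign A ?C"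
        by (subst e(1), subst blade_sign_right) (rule refl)
      ultimately show ?thesis
        unfolding e(2) by (simp add: ac_simps)
    qed
    have "(\<Sum>T\<in>UNIV. \<Sum>A\<in>UNIV. ?l T A) = (\<Sum>A\<in>UNIV. \<Sum>T\<in>UNIV. ?r A (sym_diff A T))"
      unfolding eq by (rule sum.swap)
    also have "\<dots> = (\<Sum>A\<in>UNIV. \<Sum>B\<in>UNIV. ?r A B)"
    proof (rule sum.cong[OF refl])
      fix A :: "'a set"
      show "(\<Sum>T\<in>UNIV. ?r A (sym_diff A T)) = (\<Sum>B\<in>UNIV. ?r A B)"
        by (rule sum.reindex_bij_witness[where i = "sym_diff A" and j = "sym_diff A"]) auto
    qed
    finally show "(\<Sum>T\<in>UNIV. blade_sign T (sym_diff T S) *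
          (\<Sum>A\<in>UNIV. blade_sign A (sym_diff A T) * x A * y (sym_diff A T)) * z (sym_diff T S))
        = (\<Sum>A\<in>UNIV. blade_sign A (sym_diff A S) * x A *
          (\<Sum>B\<in>UNIV. blade_sign B (sym_diff B (sym_diff A S)) * y B * z (sym_diff B (sym_diff A S))))"
      by (simp only: sum_distrib_left sum_distrib_right)
  qed
qed

end

text \<open>The inclusion of Euclidean space into its Clifford algebra.\<close>

lift_definition cl_vec :: "real ^ ('n::{finite,linorder}) \<Rightarrow> 'n clifford"
  is "\<lambda>x S. \<Sum>i | S = {i}. x $ i" .

text \<open>
  The outer product of the blades of \<open>A\<close> and \<open>B\<close> is their Clifford product if \<open>A\<close> and \<open>B\<close> are
  disjoint, and \<open>0\<close> otherwise; equivalently, it is the part of grade \<open>card A + card B\<close> of the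
  Clifford product.
\<close>

lift_definition outer :: "('n::{finite,linorder}) clifford \<Rightarrow> 'n clifford \<Rightarrow> 'n clifford"
  (infixl "\<and>\<^sub>C" 70)
  is "\<lambda>x y S. \<Sum>A\<in>Pow S. blade_sign A (S - A) * x A * y (S - A)" .

lemma blade_coeff_cl_vec_mult:
  "blade_coeff (cl_vec x * cl_vec y) S =
     (\<Sum>i\<in>UNIV. \<Sum>j\<in>UNIV. if sym_diff {i} {j} = S then blade_sign {i} {j} * x $ i * y $ j else 0)"
proof -
  have *: "(\<Sum>A\<in>UNIV. g A * (\<Sum>i | A = {i}. x $ i) * h A) = (\<Sum>i\<in>UNIV. g {i} * x $ i * h {i})"
    for g h :: "'a set \<Rightarrow> real"
  proof -
    have "(\<Sum>A\<in>UNIV. g A * (\<Sum>i | A = {i}. x $ i) * h A)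
        = (\<Sum>A\<in>UNIV. \<Sum>i\<in>UNIV. if A = {i} then g {i} * x $ i * h {i} else 0)"
      by (intro sum.cong refl)
        (auto simp: sum_distrib_left sum_distrib_right sum.If_cases intro!: sum.cong)
    also have "\<dots> = (\<Sum>i\<in>UNIV. \<Sum>A\<in>UNIV. if A = {i} then g {i} * x $ i * h {i} else 0)"
      by (rule sum.swap)
    finally show ?thesis by simp
  qed
  have "blade_coeff (cl_vec x * cl_vec y) S
      = (\<Sum>i\<in>UNIV. blade_sign {i} (sym_diff {i} S) * x $ i * (\<Sum>j | sym_diff {i} S = {j}. y $ j))"
    unfolding times_clifford.rep_eq cl_vec.rep_eq by (rule *)
  also have "\<dots> = (\<Sum>i\<in>UNIV. \<Sum>j\<in>UNIV.
      if sym_diff {i} {j} = S then blade_sign {i} {j} * x $ i * y $ j else 0)"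
  proof (intro sum.cong refl)
    fix i
    have eq: "sym_diff {i} S = {j} \<longleftrightarrow> sym_diff {i} {j} = S" for j by blast
    have "(\<Sum>j\<in>UNIV. if sym_diff {i} {j} = S then blade_sign {i} {j} * x $ i * y $ j else 0)
        = (\<Sum>j | sym_diff {i} S = {j}. blade_sign {i} {j} * x $ i * y $ j)"
      unfolding eq by (simp add: sum.If_cases)
    also have "\<dots> = (\<Sum>j | sym_diff {i} S = {j}. blade_sign {i} (sym_diff {i} S) * x $ i * y $ j)"
      by (rule sum.cong) (simp, metis (mono_tags, lifting) mem_Collect_eq)
    finally show "blade_sign {i} (sym_diff {i} S) * x $ i * (\<Sum>j | sym_diff {i} S = {j}. y $ j)
        = (\<Sum>j\<in>UNIV. if sym_diff {i} {j} = S then blade_sign {i} {j} * x $ i * y $ j else 0)"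
      by (simp add: sum_distrib_left)
  qed
  finally show ?thesis .
qed

lemma blade_coeff_of_real:
  "blade_coeff (of_real r :: ('n::{finite,linorder}) clifford) S = (if S = {} then r else 0)"
  by (simp add: of_real_def scaleR_clifford.rep_eq one_clifford.rep_eq)

lemma cl_vec_square: "cl_vec x * cl_vec x = of_real (x \<bullet> x)"
proof -
  have "blade_coeff (cl_vec x * cl_vec x) S = (if S = {} then x \<bullet> x else 0)" for S
  proof (cases "S = {}")
    case True
    have "sym_diff {i} {j} = {} \<longleftrightarrow> j = i" for i j :: 'a by blast
    then show ?thesis
      by (simp add: True blade_coeff_cl_vec_mult inner_vec_def blade_sign_def cong: if_cong)
  next
    case False
    let ?t = "\<lambda>i j. if sym_diff {i} {j} = S then blade_sign {i} {j} * x $ i * x $ j else 0"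
    have anti: "?t i j = - ?t j i" for i j
      using False by (auto simp: blade_sign_def)
    have "(\<Sum>i\<in>UNIV. \<Sum>j\<in>UNIV. ?t i j) = (\<Sum>i\<in>UNIV. \<Sum>j\<in>UNIV. - ?t j i)"
      by (intro sum.cong refl anti)
    also have "\<dots> = - (\<Sum>i\<in>UNIV. \<Sum>j\<in>UNIV. ?t j i)"
      by (simp only: sum_negf)
    also have "(\<Sum>i\<in>UNIV. \<Sum>j\<in>UNIV. ?t j i) = (\<Sum>i\<in>UNIV. \<Sum>j\<in>UNIV. ?t i j)"
      by (rule sum.swap)
    finally show ?thesis
      by (simp add: False blade_coeff_cl_vec_mult)
  qed
  then show ?thesis
    by (simp add: clifford_eq_iff blade_coeff_of_real)
qed

section \<open>Duals and brackets with respect to an orthonormal basis\<close>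

definition orthonormal_basis4 :: "(4 \<Rightarrow> real ^ 4) \<Rightarrow> bool" where
  "orthonormal_basis4 e \<longleftrightarrow> (\<forall>i j. e i \<bullet> e j = (if i = j then 1 else 0))"

text \<open>\<open>fvec e\<close> is the linear isomorphism with \<open>1, i, j, k \<mapsto> e 0, e 1, e 2, e 3\<close>.\<close>

definition fvec :: "(4 \<Rightarrow> real ^ 4) \<Rightarrow> quat \<Rightarrow> real ^ 4" where
  "fvec e q = (\<Sum>i\<in>UNIV. qcoord q $ i *\<^sub>R e i)"

definition pseudoscalar :: "(4 \<Rightarrow> real ^ 4) \<Rightarrow> 4 clifford" where
  "pseudoscalar e = cl_vec (e 0) * cl_vec (e 1) * cl_vec (e 2) * cl_vec (e 3)"

definition cl_dual :: "(4 \<Rightarrow> real ^ 4) \<Rightarrow> 4 clifford \<Rightarrow> 4 clifford" where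
  "cl_dual e X = X * pseudoscalar e"

text \<open>
  The dual of a 4-vector is a scalar and the dual of a trivector is a vector.  The next two
  definitions undo the inclusions of the reals and of \<open>real ^ 4\<close> into the Clifford algebra.
\<close>

definition bracket :: "(4 \<Rightarrow> real ^ 4) \<Rightarrow> real ^ 4 \<Rightarrow> real ^ 4 \<Rightarrow> real ^ 4 \<Rightarrow> real ^ 4 \<Rightarrow> real" where
  "bracket e x1 x2 x3 x4 =
     inv (of_real :: real \<Rightarrow> 4 clifford)
       (cl_dual e (cl_vec x1 \<and>\<^sub>C cl_vec x2 \<and>\<^sub>C cl_vec x3 \<and>\<^sub>C cl_vec x4))"

text \<open>
  With \<open>a\<close> an indexed family of quaternions, \<open>tri_dual e a p q r\<close> is the quaternion written as
  \<open>a\<close> with an over-bar, subscript \<open>pqr\<close> and superscript \<open>\<sim>\<close>.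
\<close>

definition tri_dual :: "(4 \<Rightarrow> real ^ 4) \<Rightarrow> ('i \<Rightarrow> quat) \<Rightarrow> 'i \<Rightarrow> 'i \<Rightarrow> 'i \<Rightarrow> quat" where
  "tri_dual e a p q r =
     inv (\<lambda>x. cl_vec (fvec e x))
       (cl_dual e (cl_vec (fvec e (qcnj (a p))) \<and>\<^sub>C cl_vec (fvec e (qcnj (a q)))
                    \<and>\<^sub>C cl_vec (fvec e (qcnj (a r)))))"

end

(* Writing b_p in the basis 1, i, j, k turns the tensor of the pairs c_p, b_p into the tensor of the
   four pairs (a_0, 1), (a_1, i), (a_2, j), (a_3, k).  All sums in the theorem are multilinear in the
   pairs, so they become sums over the index set {0, 1, 2, 3}, in which the inner products and brackets
   of the basis quaternions collapse to

     det A = 2 sum_ij (a_i . a_j)^2 - (sum_i |a_i|^2)^2 - 8 [a_0 a_1 a_2 a_3]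

   and the vector in the solution formula becomes w_0 d - w_1 d i - w_2 d j - w_3 d k with cubic
   expressions w_l in the a_i.  That the left side of the equation maps it to a multiple of d amounts to
   four identities between quaternions, the coefficients of d, d i, d j and d k. *)
theory Submission
  imports Defs
begin

section \<open>Quaternion coordinates\<close>

text \<open>Numerals of type \<open>4\<close> are residues modulo 4. Rules such as
  \<open>sum_4\<close> and \<open>exhaust_4\<close> list the indices as 1, 2, 3, 4, while the
  quaternion basis starts at 0; this equation reconciles the two.\<close>

lemma four_eq_zero: "(4::4) = 0" by simp

lemma sum_4_from_0: "sum f (UNIV :: 4 set) = f 0 + f 1 + f 2 + (f 3 :: 'a::comm_monoid_add)"
  by (simp add: sum_4 four_eq_zero ac_simps)

lemma qcoord_nth:
  "qcoord q $ 0 = qre q" "qcoord q $ 1 = qim1 q" "qcoord q $ 2 = qim2 q" "qcoord q $ 3 = qim3 q"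
  by (simp_all add: qcoord_def)

lemma qbasis_eq:
  "qbasis 0 = Quat 1 0 0 0" "qbasis 1 = Quat 0 1 0 0" "qbasis 2 = Quat 0 0 1 0" "qbasis 3 = Quat 0 0 0 1"
  by (simp_all add: qbasis_def one_quat_def qii_def qjj_def qkk_def)

lemmas quat_defs = times_quat_def one_quat_def qii_def qjj_def qkk_def plus_quat_def minus_quat_def
  uminus_quat_def scaleR_quat_def zero_quat_def qcnj_def

definition qdot :: "quat \<Rightarrow> quat \<Rightarrow> real" where
  "qdot x y = qre x * qre y + qim1 x * qim1 y + qim2 x * qim2 y + qim3 x * qim3 y"

text \<open>The 4 by 4 determinant, by Laplace expansion along the first two rows: the first factors
  are the bivector coefficients of \<open>outer_fvec_2\<close>.\<close>

definition qdet :: "quat \<Rightarrow> quat \<Rightarrow> quat \<Rightarrow> quat \<Rightarrow> real" where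
  "qdet x y z w =
    (qre x * qim1 y - qim1 x * qre y) * (qim2 z * qim3 w - qim3 z * qim2 w)
  - (qre x * qim2 y - qim2 x * qre y) * (qim1 z * qim3 w - qim3 z * qim1 w)
  + (qre x * qim3 y - qim3 x * qre y) * (qim1 z * qim2 w - qim2 z * qim1 w)
  + (qim1 x * qim2 y - qim2 x * qim1 y) * (qre z * qim3 w - qim3 z * qre w)
  - (qim1 x * qim3 y - qim3 x * qim1 y) * (qre z * qim2 w - qim2 z * qre w)
  + (qim2 x * qim3 y - qim3 x * qim2 y) * (qre z * qim1 w - qim1 z * qre w)"

text \<open>
  The coordinates of \<open>qtri x y z\<close> are those of the dual of the trivector spanned by the conjugates
  of \<open>x\<close>, \<open>y\<close> and \<open>z\<close>, see \<open>tri_dual_eq\<close> below.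
\<close>

definition qtri :: "quat \<Rightarrow> quat \<Rightarrow> quat \<Rightarrow> quat" where
  "qtri x y z = (let x = qcnj x; y = qcnj y; z = qcnj z
    in Quat (qdet 1 x y z) (qdet qii x y z) (qdet qjj x y z) (qdet qkk x y z))"

section \<open>Multilinearity\<close>

lemma linear_qcnj_qdot:
  "linear (\<lambda>q. qcnj q)" "linear (\<lambda>q. qdot q y)" "linear (\<lambda>q. qdot x q)"
  by (rule linearI; simp add: quat_eq_iff qdot_def quat_defs algebra_simps)+

lemma linear_qdet:
  "linear (\<lambda>q. qdet q y z w)" "linear (\<lambda>q. qdet x q z w)"
  "linear (\<lambda>q. qdet x y q w)" "linear (\<lambda>q. qdet x y z q)"
  by (rule linearI; simp add: qdet_def quat_defs algebra_simps)+

lemma linear_qtri: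
  "linear (\<lambda>q. qtri q y z)" "linear (\<lambda>q. qtri x q z)" "linear (\<lambda>q. qtri x y q)"
  by (rule linearI; simp add: quat_eq_iff qtri_def Let_def qdet_def quat_defs algebra_simps)+

lemmas multilinear_simps =
  linear_qcnj_qdot[THEN linear_add] linear_qcnj_qdot[THEN linear_scale]
  linear_qdet[THEN linear_add] linear_qdet[THEN linear_scale]
  linear_qtri[THEN linear_add] linear_qtri[THEN linear_scale]

text \<open>Both sums are images of one tensor: expanding \<open>b p\<close> in the basis and moving
  its real coordinates to the left factor collects the \<open>c p\<close> into the
  \<open>a i\<close>.\<close>

lemma sum_tensor:
  fixes f :: "quat \<Rightarrow> quat \<Rightarrow> 'v::real_vector"
  assumes lin: "\<And>y. linear (\<lambda>x. f x y)" "\<And>x. linear (\<lambda>y. f x y)"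
    and a: "\<And>i. a i = (\<Sum>p\<in>P. qcoord (b p) $ i *\<^sub>R c p)"
  shows "(\<Sum>p\<in>P. f (c p) (b p)) = (\<Sum>i\<in>UNIV. f (a i) (qbasis i))"
proof -
  have "(\<Sum>p\<in>P. f (c p) (b p)) = (\<Sum>p\<in>P. \<Sum>i\<in>UNIV. qcoord (b p) $ i *\<^sub>R f (c p) (qbasis i))"
  proof (intro sum.cong refl)
    fix p
    have "f (c p) (b p) = f (c p) (\<Sum>i\<in>UNIV. qcoord (b p) $ i *\<^sub>R qbasis i)"
      by (simp flip: quat_expansion)
    then show "f (c p) (b p) = (\<Sum>i\<in>UNIV. qcoord (b p) $ i *\<^sub>R f (c p) (qbasis i))"
      by (simp add: linear_sum[OF lin(2)] linear_scale[OF lin(2)])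
  qed
  also have "\<dots> = (\<Sum>i\<in>UNIV. \<Sum>p\<in>P. qcoord (b p) $ i *\<^sub>R f (c p) (qbasis i))"
    by (rule sum.swap)
  also have "\<dots> = (\<Sum>i\<in>UNIV. f (a i) (qbasis i))"
    by (simp add: a linear_sum[OF lin(1)] linear_scale[OF lin(1)])
  finally show ?thesis .
qed

text \<open>The arguments come in pairs, so one pair can be exchanged while the others stay fixed.
  Summing out the inner pair leaves a function still linear in both outer arguments; the longer
  versions iterate this.\<close>

lemma sum_tensor2:
  fixes f :: "quat \<Rightarrow> quat \<Rightarrow> quat \<Rightarrow> quat \<Rightarrow> 'v::real_vector"
  assumes lin: "\<And>y z w. linear (\<lambda>x. f x y z w)" "\<And>x z w. linear (\<lambda>y. f x y z w)"
      "\<And>x y w. linear (\<lambda>z. f x y z w)" "\<And>x y z. linear (\<lambda>w. f x y z w)"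
    and a: "\<And>i. a i = (\<Sum>p\<in>P. qcoord (b p) $ i *\<^sub>R c p)"
  shows "(\<Sum>p\<in>P. \<Sum>q\<in>P. f (c p) (b p) (c q) (b q)) =
    (\<Sum>i\<in>UNIV. \<Sum>j\<in>UNIV. f (a i) (qbasis i) (a j) (qbasis j))"
  unfolding sum_tensor[of "f x y" for x y, OF lin(3,4) a]
  by (rule sum_tensor[of "\<lambda>x y. \<Sum>j\<in>UNIV. f x y (a j) (qbasis j)"])
    (intro linear_compose_sum ballI lin a)+

lemma sum_tensor3:
  fixes f :: "quat \<Rightarrow> quat \<Rightarrow> quat \<Rightarrow> quat \<Rightarrow> quat \<Rightarrow> quat \<Rightarrow> 'v::real_vector"
  assumes lin: "\<And>y z w u v. linear (\<lambda>x. f x y z w u v)" "\<And>x z w u v. linear (\<lambda>y. f x y z w u v)"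
      "\<And>x y w u v. linear (\<lambda>z. f x y z w u v)" "\<And>x y z u v. linear (\<lambda>w. f x y z w u v)"
      "\<And>x y z w v. linear (\<lambda>u. f x y z w u v)" "\<And>x y z w u. linear (\<lambda>v. f x y z w u v)"
    and a: "\<And>i. a i = (\<Sum>p\<in>P. qcoord (b p) $ i *\<^sub>R c p)"
  shows "(\<Sum>p\<in>P. \<Sum>q\<in>P. \<Sum>r\<in>P. f (c p) (b p) (c q) (b q) (c r) (b r)) =
    (\<Sum>i\<in>UNIV. \<Sum>j\<in>UNIV. \<Sum>k\<in>UNIV. f (a i) (qbasis i) (a j) (qbasis j) (a k) (qbasis k))"
  unfolding sum_tensor2[of "f x y" for x y, OF lin(3,4,5,6) a]
  by (rule sum_tensor[of "\<lambda>x y. \<Sum>j\<in>UNIV. \<Sum>k\<in>UNIV. f x y (a j) (qbasis j) (a k) (qbasis k)"])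
    (intro linear_compose_sum ballI lin a)+

lemma sum_tensor4:
  fixes f :: "quat \<Rightarrow> quat \<Rightarrow> quat \<Rightarrow> quat \<Rightarrow> quat \<Rightarrow> quat \<Rightarrow> quat \<Rightarrow> quat \<Rightarrow> 'v::real_vector"
  assumes lin:
      "\<And>y z w u v s t. linear (\<lambda>x. f x y z w u v s t)" "\<And>x z w u v s t. linear (\<lambda>y. f x y z w u v s t)"
      "\<And>x y w u v s t. linear (\<lambda>z. f x y z w u v s t)" "\<And>x y z u v s t. linear (\<lambda>w. f x y z w u v s t)"
      "\<And>x y z w v s t. linear (\<lambda>u. f x y z w u v s t)" "\<And>x y z w u s t. linear (\<lambda>v. f x y z w u v s t)"
      "\<And>x y z w u v t. linear (\<lambda>s. f x y z w u v s t)" "\<And>x y z w u v s. linear (\<lambda>t. f x y z w u v s t)"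
    and a: "\<And>i. a i = (\<Sum>p\<in>P. qcoord (b p) $ i *\<^sub>R c p)"
  shows "(\<Sum>p\<in>P. \<Sum>q\<in>P. \<Sum>r\<in>P. \<Sum>s\<in>P. f (c p) (b p) (c q) (b q) (c r) (b r) (c s) (b s)) =
    (\<Sum>i\<in>UNIV. \<Sum>j\<in>UNIV. \<Sum>k\<in>UNIV. \<Sum>l\<in>UNIV.
      f (a i) (qbasis i) (a j) (qbasis j) (a k) (qbasis k) (a l) (qbasis l))"
  unfolding sum_tensor3[of "f x y" for x y, OF lin(3,4,5,6,7,8) a]
  by (rule sum_tensor[of "\<lambda>x y. \<Sum>j\<in>UNIV. \<Sum>k\<in>UNIV. \<Sum>l\<in>UNIV.
        f x y (a j) (qbasis j) (a k) (qbasis k) (a l) (qbasis l)"])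
    (intro linear_compose_sum ballI lin a)+

section \<open>Values on the basis quaternions and alternating sums\<close>

lemma qdot_qbasis: "qdot (qbasis i) (qbasis j) = (if i = j then 1 else 0)"
  using exhaust_4[of i] exhaust_4[of j] by (auto simp: four_eq_zero qbasis_eq qdot_def)

lemma qdet_swap:
  "qdet y x z w = - qdet x y z w" "qdet x z y w = - qdet x y z w" "qdet x y w z = - qdet x y z w"
  by (simp_all add: qdet_def algebra_simps)

lemma qdet_repeat:
  "qdet x x z w = 0" "qdet x y x w = 0" "qdet x y z x = 0" "qdet x y y w = 0" "qdet x y z y = 0" "qdet x y z z = 0"
  by (simp_all add: qdet_def algebra_simps)

lemma qtri_swap: "qtri y x z = - qtri x y z" "qtri x z y = - qtri x y z"
  by (simp_all add: quat_eq_iff qtri_def Let_def qdet_def quat_defs algebra_simps)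

lemma qtri_repeat: "qtri x x z = 0" "qtri x y x = 0" "qtri x y y = 0"
  by (simp_all add: quat_eq_iff qtri_def Let_def qdet_def quat_defs algebra_simps)

text \<open>
  Oriented so that the simplifier sorts the members of a family, which it cannot do with the
  permutative rules \<open>qdet_swap\<close> and \<open>qtri_swap\<close> themselves because of the sign.
\<close>

lemma qdet_sort:
  fixes a :: "4 \<Rightarrow> quat"
  shows
    "qdet (a 1) (a 0) z w = - qdet (a 0) (a 1) z w" "qdet (a 2) (a 0) z w = - qdet (a 0) (a 2) z w"
    "qdet (a 3) (a 0) z w = - qdet (a 0) (a 3) z w" "qdet (a 2) (a 1) z w = - qdet (a 1) (a 2) z w"
    "qdet (a 3) (a 1) z w = - qdet (a 1) (a 3) z w" "qdet (a 3) (a 2) z w = - qdet (a 2) (a 3) z w"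
    "qdet x (a 1) (a 0) w = - qdet x (a 0) (a 1) w" "qdet x (a 2) (a 0) w = - qdet x (a 0) (a 2) w"
    "qdet x (a 3) (a 0) w = - qdet x (a 0) (a 3) w" "qdet x (a 2) (a 1) w = - qdet x (a 1) (a 2) w"
    "qdet x (a 3) (a 1) w = - qdet x (a 1) (a 3) w" "qdet x (a 3) (a 2) w = - qdet x (a 2) (a 3) w"
    "qdet x y (a 1) (a 0) = - qdet x y (a 0) (a 1)" "qdet x y (a 2) (a 0) = - qdet x y (a 0) (a 2)"
    "qdet x y (a 3) (a 0) = - qdet x y (a 0) (a 3)" "qdet x y (a 2) (a 1) = - qdet x y (a 1) (a 2)"
    "qdet x y (a 3) (a 1) = - qdet x y (a 1) (a 3)" "qdet x y (a 3) (a 2) = - qdet x y (a 2) (a 3)"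
  by (rule qdet_swap)+

lemma qtri_sort:
  fixes a :: "4 \<Rightarrow> quat"
  shows
    "qtri (a 1) (a 0) z = - qtri (a 0) (a 1) z" "qtri (a 2) (a 0) z = - qtri (a 0) (a 2) z"
    "qtri (a 3) (a 0) z = - qtri (a 0) (a 3) z" "qtri (a 2) (a 1) z = - qtri (a 1) (a 2) z"
    "qtri (a 3) (a 1) z = - qtri (a 1) (a 3) z" "qtri (a 3) (a 2) z = - qtri (a 2) (a 3) z"
    "qtri x (a 1) (a 0) = - qtri x (a 0) (a 1)" "qtri x (a 2) (a 0) = - qtri x (a 0) (a 2)"
    "qtri x (a 3) (a 0) = - qtri x (a 0) (a 3)" "qtri x (a 2) (a 1) = - qtri x (a 1) (a 2)"
    "qtri x (a 3) (a 1) = - qtri x (a 1) (a 3)" "qtri x (a 3) (a 2) = - qtri x (a 2) (a 3)"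
  by (rule qtri_swap)+

lemma qdet_qbasis: "qdet (qbasis 0) (qbasis 1) (qbasis 2) (qbasis 3) = 1"
  by (simp add: qdet_def qbasis_eq)

lemma qtri_qbasis:
  "qtri (qbasis 1) (qbasis 2) (qbasis 3) = - 1" "qtri (qbasis 0) (qbasis 2) (qbasis 3) = - qii"
  "qtri (qbasis 0) (qbasis 1) (qbasis 3) = qjj" "qtri (qbasis 0) (qbasis 1) (qbasis 2) = - qkk"
  by (simp_all add: quat_eq_iff qtri_def Let_def qdet_def qbasis_eq quat_defs)

text \<open>Only the 24 permutations survive, and the sign from sorting the \<open>a\<close> factor
  cancels against the equal sign from sorting the \<open>qbasis\<close> factor.\<close>

lemma sum_qdet:
  fixes a :: "4 \<Rightarrow> quat"
  shows "(\<Sum>i\<in>UNIV. \<Sum>j\<in>UNIV. \<Sum>k\<in>UNIV. \<Sum>l\<in>UNIV.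
    qdet (a i) (a j) (a k) (a l) * qdet (qbasis i) (qbasis j) (qbasis k) (qbasis l))
    = 24 * qdet (a 0) (a 1) (a 2) (a 3)"
  unfolding sum_4_from_0
  by (simp add: qdet_repeat qdet_sort[where a = a] qdet_sort[where a = qbasis] qdet_qbasis)

text \<open>Each three-element index set occurs in 6 orders with cancelling signs; the remaining
  signs and units come from \<open>qtri_qbasis\<close>.\<close>

lemma sum_qtri:
  fixes a :: "4 \<Rightarrow> quat"
  shows "(\<Sum>i\<in>UNIV. \<Sum>j\<in>UNIV. \<Sum>k\<in>UNIV.
      qtri (a i) (a j) (a k) * d * qtri (qbasis i) (qbasis j) (qbasis k))
    = 6 *\<^sub>R (- qtri (a 1) (a 2) (a 3) * d - qtri (a 0) (a 2) (a 3) * d * qii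
        + qtri (a 0) (a 1) (a 3) * d * qjj - qtri (a 0) (a 1) (a 2) * d * qkk)"
proof -
  have six: "6 *\<^sub>R x = x + x + x + x + x + x" for x :: quat
    by (simp add: quat_eq_iff quat_defs)
  show ?thesis
    unfolding sum_4_from_0
    by (simp add: six qtri_repeat qtri_sort[where a = a] qtri_sort[where a = qbasis] qtri_qbasis algebra_simps)
qed

section \<open>The outer product with a vector\<close>

text \<open>The grade involution, the automorphism that extends negation of vectors. It supplies the
  parity sign in \<open>outer_cl_vec\<close>.\<close>

lift_definition grade_inv :: "('n::{finite,linorder}) clifford \<Rightarrow> 'n clifford"
  is "\<lambda>x S. (-1) ^ card S * x S" .

lemma grade_inv_scaleR: "grade_inv (r *\<^sub>R x) = r *\<^sub>R grade_inv x"
  by transfer (simp add: algebra_simps)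

lemma grade_inv_add: "grade_inv (x + y) = grade_inv x + grade_inv y"
  by transfer (simp add: algebra_simps)

lemma grade_inv_diff: "grade_inv (x - y) = grade_inv x - grade_inv y"
  by transfer (simp add: algebra_simps)

lemma grade_inv_cl_vec: "grade_inv (cl_vec v) = - cl_vec v"
proof (transfer, rule ext)
  fix v :: "real ^ ('a::{finite,linorder})" and S :: "'a set"
  show "(- 1) ^ card S * (\<Sum>i | S = {i}. v $ i) = - (\<Sum>i | S = {i}. v $ i)"
  proof (cases "\<exists>i. S = {i}")
    case False
    then show ?thesis by simp
  qed auto
qed

text \<open>The size of a symmetric difference has the parity of the sum of the sizes; this is
  \<open>prod_sym_diff\<close> for the constant factor -1.\<close>

lemma grade_inv_mult: "grade_inv (x * y) = grade_inv x * grade_inv y"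
proof (transfer, rule ext)
  fix x y :: "('a::{finite,linorder}) set \<Rightarrow> real" and S
  have "(-1::real) ^ card S = (-1) ^ card A * (-1) ^ card (sym_diff A S)" for A :: "'a set"
  proof -
    have "S = sym_diff A (sym_diff A S)" by blast
    then have "prod (\<lambda>_. - 1) S = (prod (\<lambda>_. - 1) A * prod (\<lambda>_. - 1) (sym_diff A S) :: real)"
      by (metis (no_types, lifting) prod_sym_diff minus_mult_minus mult_1)
    then show ?thesis by simp
  qed
  then show "(-1) ^ card S * (\<Sum>A\<in>UNIV. blade_sign A (sym_diff A S) * x A * y (sym_diff A S)) =
    (\<Sum>A\<in>UNIV. blade_sign A (sym_diff A S) * ((-1) ^ card A * x A)
       * ((-1) ^ card (sym_diff A S) * y (sym_diff A S)))"
    unfolding sum_distrib_left by (intro sum.cong) (simp_all add: algebra_simps)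
qed

text \<open>A vector has coefficients only on singletons, and for each \<open>i\<close> exactly one
  \<open>A\<close> has symmetric difference \<open>{i}\<close> with \<open>S\<close>. So a product
  with a vector becomes a sum over axes.\<close>

lemma sum_sym_diff_singleton:
  fixes f :: "'n::finite set \<Rightarrow> real"
  shows "(\<Sum>A\<in>UNIV. f A * (\<Sum>i | sym_diff A S = {i}. v i)) = (\<Sum>i\<in>UNIV. f (sym_diff S {i}) * v i)"
proof -
  have "(\<Sum>A\<in>UNIV. f A * (\<Sum>i | sym_diff A S = {i}. v i))
      = (\<Sum>A\<in>UNIV. \<Sum>i\<in>UNIV. if A = sym_diff S {i} then f (sym_diff S {i}) * v i else 0)"
  proof (intro sum.cong refl)
    fix A
    have eq: "sym_diff A S = {i} \<longleftrightarrow> A = sym_diff S {i}" for i by blast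
    show "f A * (\<Sum>i | sym_diff A S = {i}. v i)
      = (\<Sum>i\<in>UNIV. if A = sym_diff S {i} then f (sym_diff S {i}) * v i else 0)"
      unfolding eq by (auto simp: sum_distrib_left sum.If_cases intro!: sum.cong)
  qed
  also have "\<dots> = (\<Sum>i\<in>UNIV. \<Sum>A\<in>UNIV. if A = sym_diff S {i} then f (sym_diff S {i}) * v i else 0)"
    by (rule sum.swap)
  finally show ?thesis by simp
qed

lemma blade_coeff_mult_cl_vec:
  "blade_coeff (x * cl_vec v) S =
    (\<Sum>i\<in>UNIV. blade_sign (sym_diff S {i}) {i} * blade_coeff x (sym_diff S {i}) * v $ i)"
proof -
  have "sym_diff (sym_diff S {i}) S = {i}" for i by blast
  then show ?thesis
    unfolding times_clifford.rep_eq cl_vec.rep_eq sum_sym_diff_singleton by simp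
qed

lemma blade_coeff_cl_vec_mult_left:
  "blade_coeff (cl_vec v * x) S =
    (\<Sum>i\<in>UNIV. blade_sign {i} (sym_diff S {i}) * blade_coeff x (sym_diff S {i}) * v $ i)"
proof -
  \<comment> \<open>Writing \<open>A\<close> as \<open>sym_diff A {}\<close> makes the left factor
    fit \<open>sum_sym_diff_singleton\<close> at the empty set.\<close>
  have "blade_coeff (cl_vec v * x) S = (\<Sum>A\<in>UNIV. blade_sign A (sym_diff A S) * blade_coeff x (sym_diff A S)
     * (\<Sum>i | sym_diff A {} = {i}. v $ i))"
    unfolding times_clifford.rep_eq cl_vec.rep_eq by (intro sum.cong refl) simp
  also have "\<dots> = (\<Sum>i\<in>UNIV. blade_sign {i} (sym_diff {i} S) * blade_coeff x (sym_diff {i} S) * v $ i)"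
    unfolding sum_sym_diff_singleton by simp
  finally show ?thesis by (simp add: Un_commute)
qed

lemma blade_coeff_outer_cl_vec:
  "blade_coeff (x \<and>\<^sub>C cl_vec v) S =
    (\<Sum>i\<in>S. blade_sign (S - {i}) {i} * blade_coeff x (S - {i}) * v $ i)"
proof -
  have sd: "sym_diff A S = S - A" if "A \<subseteq> S" for A using that by blast
  have "blade_coeff (x \<and>\<^sub>C cl_vec v) S =
    (\<Sum>A\<in>UNIV. (if A \<subseteq> S then blade_sign A (sym_diff A S) * blade_coeff x A else 0)
     * (\<Sum>i | sym_diff A S = {i}. v $ i))"
    unfolding outer.rep_eq cl_vec.rep_eq
    by (rule sum.mono_neutral_cong_left) (simp_all add: sd)
  also have "\<dots> = (\<Sum>i\<in>UNIV. (if i \<in> S then blade_sign (S - {i}) {i} * blade_coeff x (S - {i}) * v $ i else 0))"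
    unfolding sum_sym_diff_singleton
  proof (intro sum.cong refl)
    fix i
    have "sym_diff (S - {i}) S = {i}" "sym_diff S {i} = S - {i}" if "i \<in> S" using that by blast+
    moreover have "\<not> sym_diff S {i} \<subseteq> S" if "i \<notin> S" using that by blast
    ultimately show "(if sym_diff S {i} \<subseteq> S
        then blade_sign (sym_diff S {i}) (sym_diff (sym_diff S {i}) S) * blade_coeff x (sym_diff S {i}) else 0) * v $ i
       = (if i \<in> S then blade_sign (S - {i}) {i} * blade_coeff x (S - {i}) * v $ i else 0)"
      by auto
  qed
  finally show ?thesis by (simp add: sum.If_cases)
qed

text \<open>Each \<open>j\<close> in \<open>A\<close> differs from \<open>i\<close>, so it gives an
  inversion in exactly one of the two orders; swapping the blades costs one factor -1 per
  element.\<close>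

lemma blade_sign_insert_swap:
  assumes "i \<notin> A"
  shows "blade_sign {i} A * (-1) ^ card A = blade_sign A {i}"
proof -
  have "blade_sign {i} A * (-1) ^ card A = (\<Prod>j\<in>A. (if j < i then - 1 else 1) * - 1)"
    unfolding prod.distrib by (simp add: blade_sign_def)
  also have "\<dots> = blade_sign A {i}"
    unfolding blade_sign_def using assms by (intro prod.cong refl) (auto simp: not_less order.order_iff_strict)
  finally show ?thesis .
qed

text \<open>
  In the Clifford products below the two summands agree on the blades containing a given axis and
  cancel on the others.  The basis independent formula makes the outer product of vectors computable in
  any orthonormal basis.
\<close>

lemma outer_cl_vec: "x \<and>\<^sub>C cl_vec v = (1/2) *\<^sub>R (x * cl_vec v + cl_vec v * grade_inv x)"
proof -
  have "blade_coeff (x * cl_vec v + cl_vec v * grade_inv x) S = 2 * blade_coeff (x \<and>\<^sub>C cl_vec v) S" for S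
  proof -
    have "blade_coeff (x * cl_vec v + cl_vec v * grade_inv x) S
      = (\<Sum>i\<in>UNIV. (blade_sign (sym_diff S {i}) {i} + blade_sign {i} (sym_diff S {i}) * (-1) ^ card (sym_diff S {i}))
           * blade_coeff x (sym_diff S {i}) * v $ i)"
      by (simp add: plus_clifford.rep_eq blade_coeff_mult_cl_vec blade_coeff_cl_vec_mult_left
        grade_inv.rep_eq algebra_simps flip: sum.distrib)
    also have "\<dots> = (\<Sum>i\<in>UNIV. if i \<in> S then 2 * (blade_sign (S - {i}) {i} * blade_coeff x (S - {i}) * v $ i) else 0)"
    proof (intro sum.cong refl)
      fix i
      let ?s = "blade_sign (sym_diff S {i}) {i} + blade_sign {i} (sym_diff S {i}) * (-1) ^ card (sym_diff S {i})"
      show "?s * blade_coeff x (sym_diff S {i}) * v $ i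
        = (if i \<in> S then 2 * (blade_sign (S - {i}) {i} * blade_coeff x (S - {i}) * v $ i) else 0)"
      proof (cases "i \<in> S")
        case True
        then have "sym_diff S {i} = S - {i}" by blast
        then show ?thesis using True blade_sign_insert_swap[of i "S - {i}"] by simp
      next
        case False
        then have eq: "sym_diff S {i} = insert i S" by blast
        \<comment> \<open>The pair of \<open>i\<close> with itself is no inversion, so adding
          \<open>i\<close> to the set leaves both signs unchanged.\<close>
        have "blade_sign (insert i S) {i} = blade_sign S {i}" "blade_sign {i} (insert i S) = blade_sign {i} S"
          using False by (simp_all add: blade_sign_def)
        then show ?thesis
          using False blade_sign_insert_swap[of i S] by (simp add: eq)
      qed
    qed
    finally show ?thesis
      by (simp add: sum.If_cases blade_coeff_outer_cl_vec sum_distrib_left)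
  qed
  then show ?thesis by (simp add: clifford_eq_iff scaleR_clifford.rep_eq)
qed

text \<open>Vectors and trivectors are odd and bivectors even under \<open>grade_inv\<close>, so the
  successive outer products are half a commutator, half an anticommutator and half a
  commutator.\<close>

lemma outer_cl_vec_2: "cl_vec x \<and>\<^sub>C cl_vec y = (1/2) *\<^sub>R (cl_vec x * cl_vec y - cl_vec y * cl_vec x)"
  by (simp add: outer_cl_vec grade_inv_cl_vec)

lemma grade_inv_outer_2: "grade_inv (cl_vec x \<and>\<^sub>C cl_vec y) = cl_vec x \<and>\<^sub>C cl_vec y"
  by (simp add: outer_cl_vec_2 grade_inv_scaleR grade_inv_diff grade_inv_mult grade_inv_cl_vec)

lemma outer_cl_vec_3: "cl_vec x \<and>\<^sub>C cl_vec y \<and>\<^sub>C cl_vec z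
  = (1/2) *\<^sub>R (cl_vec x \<and>\<^sub>C cl_vec y * cl_vec z + cl_vec z * (cl_vec x \<and>\<^sub>C cl_vec y))"
  by (simp add: outer_cl_vec[of "cl_vec x \<and>\<^sub>C cl_vec y"] grade_inv_outer_2)

lemma grade_inv_outer_3: "grade_inv (cl_vec x \<and>\<^sub>C cl_vec y \<and>\<^sub>C cl_vec z) = - (cl_vec x \<and>\<^sub>C cl_vec y \<and>\<^sub>C cl_vec z)"
  by (simp add: outer_cl_vec_3 grade_inv_scaleR grade_inv_add grade_inv_mult grade_inv_cl_vec grade_inv_outer_2
      flip: scaleR_minus_right)

lemma outer_cl_vec_4: "cl_vec x \<and>\<^sub>C cl_vec y \<and>\<^sub>C cl_vec z \<and>\<^sub>C cl_vec w
  = (1/2) *\<^sub>R (cl_vec x \<and>\<^sub>C cl_vec y \<and>\<^sub>C cl_vec z * cl_vec w - cl_vec w * (cl_vec x \<and>\<^sub>C cl_vec y \<and>\<^sub>C cl_vec z))"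
  by (simp add: outer_cl_vec[of "cl_vec x \<and>\<^sub>C cl_vec y \<and>\<^sub>C cl_vec z"] grade_inv_outer_3)

section \<open>Vectors inside the Clifford algebra\<close>

lemma cl_vec_add: "cl_vec (x + y) = cl_vec x + cl_vec y"
  by transfer (simp add: sum.distrib)

lemma cl_vec_scaleR: "cl_vec (r *\<^sub>R x) = r *\<^sub>R cl_vec x"
  by transfer (simp add: sum_distrib_left)

lemma inj_cl_vec: "inj (cl_vec :: real ^ ('n::{finite,linorder}) \<Rightarrow> _)"
proof (rule injI)
  fix x y :: "real ^ ('n::{finite,linorder})"
  assume "cl_vec x = cl_vec y"
  then have "blade_coeff (cl_vec x) {i} = blade_coeff (cl_vec y) {i}" for i by simp
  then show "x = y" by (simp add: cl_vec.rep_eq vec_eq_iff)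
qed

text \<open>Polarization of \<open>cl_vec_square\<close> at \<open>x + y\<close>.\<close>

lemma cl_vec_anticommute:
  assumes "x \<bullet> y = 0"
  shows "cl_vec y * cl_vec x = - (cl_vec x * cl_vec y)"
proof -
  have "cl_vec (x + y) * cl_vec (x + y) = cl_vec x * cl_vec x + cl_vec y * cl_vec y"
    using assms by (simp add: cl_vec_square inner_add inner_commute)
  then have "cl_vec y * cl_vec x + cl_vec x * cl_vec y = 0"
    by (simp add: cl_vec_add algebra_simps)
  then show ?thesis by (simp add: eq_neg_iff_add_eq_0)
qed

lemma fvec_expand: "fvec e q = qre q *\<^sub>R e 0 + qim1 q *\<^sub>R e 1 + qim2 q *\<^sub>R e 2 + qim3 q *\<^sub>R e 3"
  by (simp add: fvec_def sum_4_from_0 qcoord_nth)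

section \<open>Computations in an arbitrary orthonormal frame\<close>

locale orthonormal_frame = fixes e :: "4 \<Rightarrow> real ^ 4" assumes orthonormal: "orthonormal_basis4 e"
begin

lemma inner_basis: "e i \<bullet> e j = (if i = j then 1 else 0)"
  using orthonormal by (simp add: orthonormal_basis4_def)

lemma inner_fvec: "fvec e x \<bullet> fvec e y = qdot x y"
  by (simp add: fvec_expand qdot_def inner_basis inner_add_left inner_add_right)

lemma inj_fvec: "inj (fvec e)"
proof (rule injI)
  fix x y assume "fvec e x = fvec e y"
  then have "fvec e x \<bullet> e i = fvec e y \<bullet> e i" for i by simp
  from this[of 0] this[of 1] this[of 2] this[of 3] show "x = y"
    by (simp add: fvec_expand inner_basis inner_add_left quat_eq_iff)
qed

text \<open>The version with a tail \<open>t\<close> lets the rule act inside right-nested products;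
  \<open>basis_anticommute\<close> uses the same device.\<close>

lemma basis_square: "cl_vec (e i) * cl_vec (e i) = 1" "cl_vec (e i) * (cl_vec (e i) * t) = t"
proof -
  show 1: "cl_vec (e i) * cl_vec (e i) = 1" by (simp add: cl_vec_square inner_basis)
  show "cl_vec (e i) * (cl_vec (e i) * t) = t" unfolding mult.assoc[symmetric] 1 by simp
qed

lemma basis_anticommute:
  assumes "i \<noteq> j"
  shows "cl_vec (e i) * cl_vec (e j) = - (cl_vec (e j) * cl_vec (e i))"
    and "cl_vec (e i) * (cl_vec (e j) * t) = - (cl_vec (e j) * (cl_vec (e i) * t))"
proof -
  show 1: "cl_vec (e i) * cl_vec (e j) = - (cl_vec (e j) * cl_vec (e i))"
    by (rule cl_vec_anticommute) (use assms in \<open>simp add: inner_basis\<close>)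
  show "cl_vec (e i) * (cl_vec (e j) * t) = - (cl_vec (e j) * (cl_vec (e i) * t))"
    unfolding mult.assoc[symmetric] 1 by simp
qed

abbreviation "g i \<equiv> cl_vec (e i)"

text \<open>The swaps are instantiated at decreasing indices only, so rewriting terminates and
  brings products of frame vectors into increasing order without repetition.\<close>

lemmas basis_normalize =
  basis_square
  basis_anticommute(1)[of 1 0, simplified] basis_anticommute(1)[of 2 0, simplified] basis_anticommute(1)[of 3 0, simplified]
  basis_anticommute(1)[of 2 1, simplified] basis_anticommute(1)[of 3 1, simplified] basis_anticommute(1)[of 3 2, simplified]
  basis_anticommute(2)[of 1 0, simplified] basis_anticommute(2)[of 2 0, simplified] basis_anticommute(2)[of 3 0, simplified]
  basis_anticommute(2)[of 2 1, simplified] basis_anticommute(2)[of 3 1, simplified] basis_anticommute(2)[of 3 2, simplified]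

lemma cl_vec_fvec: "cl_vec (fvec e q) = qre q *\<^sub>R g 0 + qim1 q *\<^sub>R g 1 + qim2 q *\<^sub>R g 2 + qim3 q *\<^sub>R g 3"
  by (simp add: fvec_expand cl_vec_add cl_vec_scaleR)

lemma half_eq: "(1/2) *\<^sub>R a = b \<longleftrightarrow> a = b + b" for a b :: "4 clifford"
  by (auto simp flip: scaleR_2)

lemma outer_fvec_2: "cl_vec (fvec e x) \<and>\<^sub>C cl_vec (fvec e y) =
    (qre x * qim1 y - qim1 x * qre y) *\<^sub>R (g 0 * g 1)
  + (qre x * qim2 y - qim2 x * qre y) *\<^sub>R (g 0 * g 2)
  + (qre x * qim3 y - qim3 x * qre y) *\<^sub>R (g 0 * g 3)
  + (qim1 x * qim2 y - qim2 x * qim1 y) *\<^sub>R (g 1 * g 2)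
  + (qim1 x * qim3 y - qim3 x * qim1 y) *\<^sub>R (g 1 * g 3)
  + (qim2 x * qim3 y - qim3 x * qim2 y) *\<^sub>R (g 2 * g 3)"
  unfolding outer_cl_vec_2 unfolding cl_vec_fvec half_eq
  by (simp add: algebra_simps basis_normalize)

text \<open>Symbolic coefficients keep the products small; the minors of \<open>outer_fvec_2\<close>
  are substituted only afterwards.\<close>

lemma outer_bivector_fvec:
  assumes "B = b01 *\<^sub>R (g 0 * g 1) + b02 *\<^sub>R (g 0 * g 2) + b03 *\<^sub>R (g 0 * g 3)
     + b12 *\<^sub>R (g 1 * g 2) + b13 *\<^sub>R (g 1 * g 3) + b23 *\<^sub>R (g 2 * g 3)"
  shows "(1/2) *\<^sub>R (B * cl_vec (fvec e z) + cl_vec (fvec e z) * B) =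
     (b12 * qim3 z - b13 * qim2 z + b23 * qim1 z) *\<^sub>R (g 1 * (g 2 * g 3))
   + (b02 * qim3 z - b03 * qim2 z + b23 * qre z) *\<^sub>R (g 0 * (g 2 * g 3))
   + (b01 * qim3 z - b03 * qim1 z + b13 * qre z) *\<^sub>R (g 0 * (g 1 * g 3))
   + (b01 * qim2 z - b02 * qim1 z + b12 * qre z) *\<^sub>R (g 0 * (g 1 * g 2))"
  unfolding assms cl_vec_fvec half_eq
  by (simp add: algebra_simps basis_normalize)

lemma trivector_dual:
  "cl_dual e (t0 *\<^sub>R (g 1 * (g 2 * g 3)) + t1 *\<^sub>R (g 0 * (g 2 * g 3))
    + t2 *\<^sub>R (g 0 * (g 1 * g 3)) + t3 *\<^sub>R (g 0 * (g 1 * g 2)))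
  = cl_vec (fvec e (Quat t0 (- t1) t2 (- t3)))"
  unfolding cl_dual_def pseudoscalar_def cl_vec_fvec
  by (simp add: algebra_simps basis_normalize)

lemma dual_outer_trivector_fvec:
  assumes "T = t0 *\<^sub>R (g 1 * (g 2 * g 3)) + t1 *\<^sub>R (g 0 * (g 2 * g 3))
    + t2 *\<^sub>R (g 0 * (g 1 * g 3)) + t3 *\<^sub>R (g 0 * (g 1 * g 2))"
  shows "cl_dual e ((1/2) *\<^sub>R (T * cl_vec (fvec e w) - cl_vec (fvec e w) * T))
    = of_real (t3 * qim3 w - t2 * qim2 w + t1 * qim1 w - t0 * qre w)"
proof -
  have "(1/2) *\<^sub>R (T * cl_vec (fvec e w) - cl_vec (fvec e w) * T)
    = (t3 * qim3 w - t2 * qim2 w + t1 * qim1 w - t0 * qre w) *\<^sub>R (g 0 * (g 1 * (g 2 * g 3)))"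
    unfolding assms cl_vec_fvec half_eq
    by (simp add: algebra_simps basis_normalize)
  \<comment> \<open>The pseudoscalar squares to 1 in positive signature and dimension four, so the
    dual of a 4-vector is its coefficient.\<close>
  then show ?thesis
    unfolding cl_dual_def pseudoscalar_def of_real_def
    by (simp add: mult.assoc basis_normalize)
qed

text \<open>The coordinates of the dual are cofactors, that is, determinants with a basis quaternion
  as first row; injectivity of the vector inclusion evaluates the \<open>inv\<close> in the
  definition.\<close>

lemma tri_dual_eq: "tri_dual e a p q r = qtri (a p) (a q) (a r)"
proof -
  have "cl_dual e (cl_vec (fvec e x) \<and>\<^sub>C cl_vec (fvec e y) \<and>\<^sub>C cl_vec (fvec e z))
    = cl_vec (fvec e (Quat (qdet 1 x y z) (qdet qii x y z) (qdet qjj x y z) (qdet qkk x y z)))" for x y z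
    unfolding outer_cl_vec_3 outer_bivector_fvec[OF outer_fvec_2] trivector_dual
    by (rule arg_cong[where f = "\<lambda>q. cl_vec (fvec e q)"])
      (simp add: qdet_def one_quat_def qii_def qjj_def qkk_def algebra_simps)
  note dual = this
  have inj: "inj (\<lambda>x. cl_vec (fvec e x))"
    using inj_compose[OF inj_cl_vec inj_fvec] by (simp add: comp_def)
  show ?thesis
    unfolding tri_dual_def qtri_def Let_def dual using inj by (rule inv_f_eq) (rule refl)
qed

lemma bracket_eq: "bracket e (fvec e x) (fvec e y) (fvec e z) (fvec e w) = qdet x y z w"
proof -
  have "cl_dual e (cl_vec (fvec e x) \<and>\<^sub>C cl_vec (fvec e y) \<and>\<^sub>C cl_vec (fvec e z) \<and>\<^sub>C cl_vec (fvec e w))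
    = of_real (qdet x y z w)"
    unfolding outer_cl_vec_4
    unfolding dual_outer_trivector_fvec[OF outer_bivector_fvec[OF outer_fvec_2, folded outer_cl_vec_3]]
    by (rule arg_cong[where f = of_real]) (simp add: qdet_def algebra_simps)
  then show ?thesis
    unfolding bracket_def by (simp add: inv_f_f inj_of_real)
qed

end

section \<open>The determinant and the adjugate\<close>

text \<open>Peeling off one index at a time yields the 24 terms; they are grouped as the Laplace
  expansion by rows 1 and 2, matching \<open>qdet\<close>.\<close>

lemma det_4:
  "det (A :: 'a::comm_ring_1 ^ 4 ^ 4) =
    (A$1$1 * A$2$2 - A$1$2 * A$2$1) * (A$3$3 * A$4$4 - A$3$4 * A$4$3)
  - (A$1$1 * A$2$3 - A$1$3 * A$2$1) * (A$3$2 * A$4$4 - A$3$4 * A$4$2)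
  + (A$1$1 * A$2$4 - A$1$4 * A$2$1) * (A$3$2 * A$4$3 - A$3$3 * A$4$2)
  + (A$1$2 * A$2$3 - A$1$3 * A$2$2) * (A$3$1 * A$4$4 - A$3$4 * A$4$1)
  - (A$1$2 * A$2$4 - A$1$4 * A$2$2) * (A$3$1 * A$4$3 - A$3$3 * A$4$1)
  + (A$1$3 * A$2$4 - A$1$4 * A$2$3) * (A$3$1 * A$4$2 - A$3$2 * A$4$1)"
proof -
  have f1: "finite {2, 3, 4 :: 4}" "1 \<notin> {2, 3, 4 :: 4}"
    and f2: "finite {3, 4 :: 4}" "2 \<notin> {3, 4 :: 4}"
    and f3: "finite {4 :: 4}" "3 \<notin> {4 :: 4}"
    by auto
  show ?thesis
    unfolding det_def UNIV_4
      sum_over_permutations_insert[OF f1] sum_over_permutations_insert[OF f2]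
      sum_over_permutations_insert[OF f3] permutes_sing
    by (simp add: sign_swap_id permutation_swap_id sign_compose sign_id
        Transposition.transpose_def permutation_compose)
      (simp only: algebra_simps)
qed

definition qform :: "quat \<Rightarrow> quat \<Rightarrow> quat \<Rightarrow> quat \<Rightarrow> real" where
  "qform a0 a1 a2 a3 = 2 * (qdot a0 a0 ^ 2 + qdot a1 a1 ^ 2 + qdot a2 a2 ^ 2 + qdot a3 a3 ^ 2
      + 2 * (qdot a0 a1 ^ 2 + qdot a0 a2 ^ 2 + qdot a0 a3 ^ 2 + qdot a1 a2 ^ 2 + qdot a1 a3 ^ 2 + qdot a2 a3 ^ 2))
    - (qdot a0 a0 + qdot a1 a1 + qdot a2 a2 + qdot a3 a3)^2 - 8 * qdet a0 a1 a2 a3"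

text \<open>
  The last argument \<open>t\<close> stands for the contribution of the trivector duals; up to sign it is \<open>qtri\<close> of
  the three members of the family other than \<open>x\<close>.
\<close>

definition adj_coeff :: "quat \<Rightarrow> quat \<Rightarrow> quat \<Rightarrow> quat \<Rightarrow> quat \<Rightarrow> quat \<Rightarrow> quat" where
  "adj_coeff a0 a1 a2 a3 x t =
    2 *\<^sub>R t + (qdot a0 a0 + qdot a1 a1 + qdot a2 a2 + qdot a3 a3) *\<^sub>R qcnj x
    - 2 *\<^sub>R (qdot a0 x *\<^sub>R qcnj a0 + qdot a1 x *\<^sub>R qcnj a1 + qdot a2 x *\<^sub>R qcnj a2 + qdot a3 x *\<^sub>R qcnj a3)"

text \<open>This plays the role of minus the adjugate applied to \<open>d\<close>, see
  \<open>qadj_solves\<close>. The minus signs before the last three terms come from conjugating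
  \<open>qii\<close>, \<open>qjj\<close> and \<open>qkk\<close>.\<close>

definition qadj :: "quat \<Rightarrow> quat \<Rightarrow> quat \<Rightarrow> quat \<Rightarrow> quat \<Rightarrow> quat" where
  "qadj a0 a1 a2 a3 d =
      adj_coeff a0 a1 a2 a3 a0 (- qtri a1 a2 a3) * d
    - adj_coeff a0 a1 a2 a3 a1 (qtri a0 a2 a3) * d * qii
    - adj_coeff a0 a1 a2 a3 a2 (- qtri a0 a1 a3) * d * qjj
    - adj_coeff a0 a1 a2 a3 a3 (qtri a0 a1 a2) * d * qkk"

section \<open>Polynomial identities in the sixteen coordinates\<close>

lemma qmatrix_nth: "qmatrix L $ i $ j = qcoord (L (qbasis j)) $ i"
  by (simp add: qmatrix_def)

lemma det_qmatrix_sum: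
  fixes a0 a1 a2 a3 :: quat
  assumes "A = qmatrix (qop a0 1) + qmatrix (qop a1 qii)
           + qmatrix (qop a2 qjj) + qmatrix (qop a3 qkk)"
  shows "det A = qform a0 a1 a2 a3"
  unfolding qform_def qdot_def qdet_def assms det_4 four_eq_zero
  by (simp only: vector_add_component qmatrix_nth qop_def qcoord_nth qbasis_eq quat_defs quat.sel)
    algebra

text \<open>These are the coefficients of \<open>d\<close>, \<open>d * qii\<close>,
  \<open>d * qjj\<close> and \<open>d * qkk\<close> after \<open>qadj\<close> is put into the left
  side of the equation.\<close>

lemma adj_coeff_identities:
  fixes a0 a1 a2 a3
  defines "w0 \<equiv> adj_coeff a0 a1 a2 a3 a0 (- qtri a1 a2 a3)"
      and "w1 \<equiv> adj_coeff a0 a1 a2 a3 a1 (qtri a0 a2 a3)"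
      and "w2 \<equiv> adj_coeff a0 a1 a2 a3 a2 (- qtri a0 a1 a3)"
      and "w3 \<equiv> adj_coeff a0 a1 a2 a3 a3 (qtri a0 a1 a2)"
  shows "a0 * w0 + a1 * w1 + a2 * w2 + a3 * w3 = - of_real (qform a0 a1 a2 a3)"
    and "a1 * w0 - a0 * w1 + a2 * w3 - a3 * w2 = 0"
    and "a2 * w0 - a0 * w2 + a3 * w1 - a1 * w3 = 0"
    and "a3 * w0 - a0 * w3 + a1 * w2 - a2 * w1 = 0"
proof -
  obtain x0 x1 x2 x3 where a0: "a0 = Quat x0 x1 x2 x3" by (cases a0)
  obtain y0 y1 y2 y3 where a1: "a1 = Quat y0 y1 y2 y3" by (cases a1)
  obtain z0 z1 z2 z3 where a2: "a2 = Quat z0 z1 z2 z3" by (cases a2)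
  obtain u0 u1 u2 u3 where a3: "a3 = Quat u0 u1 u2 u3" by (cases a3)
  note defs = w0_def w1_def w2_def w3_def adj_coeff_def quat_eq_iff qtri_def Let_def qform_def
    a0 a1 a2 a3 qdot_def qdet_def of_real_def quat_defs quat.sel
  show "a0 * w0 + a1 * w1 + a2 * w2 + a3 * w3 = - of_real (qform a0 a1 a2 a3)"
    unfolding defs by (intro conjI; algebra)
  show "a1 * w0 - a0 * w1 + a2 * w3 - a3 * w2 = 0"
    unfolding defs by (intro conjI; algebra)
  show "a2 * w0 - a0 * w2 + a3 * w1 - a1 * w3 = 0"
    unfolding defs by (intro conjI; algebra)
  show "a3 * w0 - a0 * w3 + a1 * w2 - a2 * w1 = 0"
    unfolding defs by (intro conjI; algebra)
qed

lemma qadj_solves: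
  "a0 * qadj a0 a1 a2 a3 d + a1 * qadj a0 a1 a2 a3 d * qii
   + a2 * qadj a0 a1 a2 a3 d * qjj + a3 * qadj a0 a1 a2 a3 d * qkk = - (qform a0 a1 a2 a3 *\<^sub>R d)"
proof -
  define w0 where "w0 = adj_coeff a0 a1 a2 a3 a0 (- qtri a1 a2 a3)"
  define w1 where "w1 = adj_coeff a0 a1 a2 a3 a1 (qtri a0 a2 a3)"
  define w2 where "w2 = adj_coeff a0 a1 a2 a3 a2 (- qtri a0 a1 a3)"
  define w3 where "w3 = adj_coeff a0 a1 a2 a3 a3 (qtri a0 a1 a2)"
  note w = w0_def[symmetric] w1_def[symmetric] w2_def[symmetric] w3_def[symmetric]
  define W where "W = w0 * d - w1 * d * qii - w2 * d * qjj - w3 * d * qkk"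
  \<comment> \<open>Right multiplication by a unit permutes the units after \<open>d\<close> up to
    sign, so the terms regroup by that unit.\<close>
  have "a0 * W + a1 * W * qii + a2 * W * qjj + a3 * W * qkk =
      (a0 * w0 + a1 * w1 + a2 * w2 + a3 * w3) * d
    + (a1 * w0 - a0 * w1 + a2 * w3 - a3 * w2) * d * qii
    + (a2 * w0 - a0 * w2 + a3 * w1 - a1 * w3) * d * qjj
    + (a3 * w0 - a0 * w3 + a1 * w2 - a2 * w1) * d * qkk"
    unfolding W_def by (simp add: algebra_simps quat_unit_products)
  also have "\<dots> = - (qform a0 a1 a2 a3 *\<^sub>R d)"
    using adj_coeff_identities[where ?a0.0 = a0 and ?a1.0 = a1 and ?a2.0 = a2 and ?a3.0 = a3, unfolded w]
    by (simp add: of_real_def)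
  finally show ?thesis by (simp only: qadj_def w W_def)
qed

text \<open>The Kronecker deltas leave double sums; collecting them by the unit on the right yields
  \<open>adj_coeff\<close>. The 6 of \<open>sum_qtri\<close> is 3 times the 2 in front of
  \<open>t\<close> there.\<close>

lemma sum_qadj:
  fixes a :: "4 \<Rightarrow> quat"
  shows "(\<Sum>i\<in>UNIV. \<Sum>j\<in>UNIV. \<Sum>k\<in>UNIV.
      qtri (a i) (a j) (a k) * d * qtri (qbasis i) (qbasis j) (qbasis k)
      + (3 * qdot (a i) (a j)) *\<^sub>R
          (qdot (qbasis i) (qbasis j) *\<^sub>R (qcnj (a k) * d * qcnj (qbasis k))
           - (2 * qdot (qbasis i) (qbasis k)) *\<^sub>R (qcnj (a k) * d * qcnj (qbasis j))))
    = 3 *\<^sub>R qadj (a 0) (a 1) (a 2) (a 3) d"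
proof -
  have cnj: "qcnj (qbasis 0) = 1" "qcnj (qbasis 1) = - qii" "qcnj (qbasis 2) = - qjj" "qcnj (qbasis 3) = - qkk"
    by (simp_all add: quat_eq_iff qbasis_eq quat_defs)
  show ?thesis
    unfolding sum.distrib sum_qtri qadj_def adj_coeff_def
    unfolding sum_4_from_0
    by (simp add: qdot_qbasis cnj algebra_simps)
qed

text \<open>Two deltas reduce the fourfold sum to squares of inner products, and the 8 in
  \<open>qform\<close> is the 24 of \<open>sum_qdet\<close> divided by 3.\<close>

lemma qform_eq_sums:
  fixes a :: "4 \<Rightarrow> quat"
  shows "2 * (\<Sum>i\<in>UNIV. \<Sum>j\<in>UNIV. \<Sum>k\<in>UNIV. \<Sum>l\<in>UNIV.
        qdot (a i) (a j) * qdot (a k) (a l) * qdot (qbasis i) (qbasis k) * qdot (qbasis j) (qbasis l))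
      - (\<Sum>i\<in>UNIV. \<Sum>j\<in>UNIV. qdot (a i) (a j) * qdot (qbasis i) (qbasis j))\<^sup>2
      - 1/3 * (\<Sum>i\<in>UNIV. \<Sum>j\<in>UNIV. \<Sum>k\<in>UNIV. \<Sum>l\<in>UNIV.
        qdet (a i) (a j) (a k) (a l) * qdet (qbasis i) (qbasis j) (qbasis k) (qbasis l))
    = qform (a 0) (a 1) (a 2) (a 3)"
proof -
  have 1: "(\<Sum>i\<in>UNIV. \<Sum>j\<in>UNIV. \<Sum>k\<in>UNIV. \<Sum>l\<in>UNIV.
        qdot (a i) (a j) * qdot (a k) (a l) * qdot (qbasis i) (qbasis k) * qdot (qbasis j) (qbasis l))
      = (\<Sum>i\<in>UNIV. \<Sum>j\<in>UNIV. (qdot (a i) (a j))\<^sup>2)"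
    by (simp add: qdot_qbasis if_distrib[of "\<lambda>x. _ * x"] power2_eq_square cong: if_cong)
  have 2: "(\<Sum>i\<in>UNIV. \<Sum>j\<in>UNIV. qdot (a i) (a j) * qdot (qbasis i) (qbasis j)) = (\<Sum>i\<in>UNIV. qdot (a i) (a i))"
    by (simp add: qdot_qbasis if_distrib[of "\<lambda>x. _ * x"] cong: if_cong)
  have comm: "qdot x y = qdot y x" for x y by (simp add: qdot_def)
  note sym = comm[of "a 1" "a 0"] comm[of "a 2" "a 0"] comm[of "a 3" "a 0"]
    comm[of "a 2" "a 1"] comm[of "a 3" "a 1"] comm[of "a 3" "a 2"]
  show ?thesis
    unfolding 1 2 sum_qdet qform_def unfolding sum_4_from_0 sym by simp
qed

section \<open>Linear systems over the quaternions\<close>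

lemma linear_qcoord: "linear qcoord"
  by (rule linearI) (simp_all add: vec_eq_iff qcoord_def quat_defs)

lemma qcoord_inject: "qcoord x = qcoord y \<longleftrightarrow> x = y"
  by (metis quat_expansion)

lemma surj_qcoord: "\<exists>x. qcoord x = v"
proof
  show "qcoord (Quat (v $ 0) (v $ 1) (v $ 2) (v $ 3)) = v"
    by (simp add: vec_eq_iff forall_4 four_eq_zero qcoord_nth)
qed

lemma ex1_qcoord: "(\<exists>!x. P (qcoord x)) \<longleftrightarrow> (\<exists>!v. P v)"
proof -
  have "(\<exists>v. Q v) \<longleftrightarrow> (\<exists>x. Q (qcoord x))" "(\<forall>v. Q v) \<longleftrightarrow> (\<forall>x. Q (qcoord x))" for Q
    by (metis surj_qcoord)+
  then show ?thesis
    unfolding Ex1_def by (simp only: qcoord_inject)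
qed

lemma qmatrix_mult_qcoord:
  assumes "linear L"
  shows "qmatrix L *v qcoord x = qcoord (L x)"
proof -
  have "L x = (\<Sum>j\<in>UNIV. qcoord x $ j *\<^sub>R L (qbasis j))"
    by (subst quat_expansion[of x]) (simp add: linear_sum[OF assms] linear_scale[OF assms])
  then show ?thesis
    by (simp add: vec_eq_iff matrix_vector_mult_def qmatrix_nth linear_sum[OF linear_qcoord]
        linear_scale[OF linear_qcoord] mult.commute)
qed

lemma linear_qop: "linear (qop u v)"
  by (rule linearI) (simp_all add: qop_def algebra_simps)

text \<open>Uniqueness for a single right-hand side already forces a trivial kernel, since adding a
  kernel vector to the solution gives another solution.\<close>

lemma ex1_solution_iff_det:
  fixes A :: "real ^ 'n ^ 'n"
  shows "(\<exists>!v. A *v v = y) \<longleftrightarrow> det A \<noteq> 0"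
proof
  assume "\<exists>!v. A *v v = y"
  then obtain v where v: "A *v v = y" "\<And>w. A *v w = y \<Longrightarrow> w = v" by auto
  have "inj ((*v) A)"
  proof (rule injI)
    fix u w assume "A *v u = A *v w"
    then have "A *v (v + (u - w)) = y"
      by (simp add: v(1) matrix_vector_right_distrib matrix_vector_mult_diff_distrib)
    then show "u = w" using v(2) by force
  qed
  then show "det A \<noteq> 0"
    by (simp add: invertible_left_inverse matrix_left_invertible_injective flip: invertible_det_nz)
next
  assume "det A \<noteq> 0"
  then have "invertible A" by (simp add: invertible_det_nz)
  then obtain B where "A ** B = mat 1" "B ** A = mat 1" by (auto simp: invertible_def)
  then show "\<exists>!v. A *v v = y"
    by (metis matrix_vector_mul_assoc matrix_vector_mul_lid)
qed

theorem theorem4p3: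
  fixes n :: nat and c b :: "nat \<Rightarrow> quat" and d :: quat
    and e :: "4 \<Rightarrow> real ^ 4" and a :: "4 \<Rightarrow> quat" and A :: "real ^ 4 ^ 4"
  assumes "n \<ge> 2"
    and "orthonormal_basis4 e"
    and "\<And>i. a i = (\<Sum>p=1..n-1. qcoord (b p) $ i *\<^sub>R c p)"
    and "A = qmatrix (qop (a 0) 1) + qmatrix (qop (a 1) qii)
           + qmatrix (qop (a 2) qjj) + qmatrix (qop (a 3) qkk)"
  shows "(\<forall>x. (\<Sum>p=1..n-1. c p * x * b p) = d \<longleftrightarrow> A *v qcoord x = qcoord d)
    \<and> det A =
        2 * (\<Sum>p=1..n-1. \<Sum>q=1..n-1. \<Sum>r=1..n-1. \<Sum>s=1..n-1.
               (fvec e (c p) \<bullet> fvec e (c q)) * (fvec e (c r) \<bullet> fvec e (c s))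
             * (fvec e (b p) \<bullet> fvec e (b r)) * (fvec e (b q) \<bullet> fvec e (b s)))
        - (\<Sum>p=1..n-1. \<Sum>q=1..n-1.
               (fvec e (c p) \<bullet> fvec e (c q)) * (fvec e (b p) \<bullet> fvec e (b q)))\<^sup>2
        - 1/3 * (\<Sum>p=1..n-1. \<Sum>q=1..n-1. \<Sum>r=1..n-1. \<Sum>s=1..n-1.
               bracket e (fvec e (c p)) (fvec e (c q)) (fvec e (c r)) (fvec e (c s))
             * bracket e (fvec e (b p)) (fvec e (b q)) (fvec e (b r)) (fvec e (b s)))
    \<and> ((\<exists>!x. (\<Sum>p=1..n-1. c p * x * b p) = d) \<longleftrightarrow> det A \<noteq> 0)
    \<and> (det A \<noteq> 0 \<longrightarrow>
        (\<forall>x. (\<Sum>p=1..n-1. c p * x * b p) = d \<longleftrightarrow>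
          x = (-1 / (3 * det A)) *\<^sub>R
            (\<Sum>p=1..n-1. \<Sum>q=1..n-1. \<Sum>r=1..n-1.
               tri_dual e c p q r * d * tri_dual e b p q r
               + (3 * (fvec e (c p) \<bullet> fvec e (c q))) *\<^sub>R
                   ((fvec e (b p) \<bullet> fvec e (b q)) *\<^sub>R (qcnj (c r) * d * qcnj (b r))
                    - (2 * (fvec e (b p) \<bullet> fvec e (b r))) *\<^sub>R (qcnj (c r) * d * qcnj (b q))))))"
proof -
  define D where "D = qform (a 0) (a 1) (a 2) (a 3)"
  interpret orthonormal_frame e by unfold_locales (rule assms(2))
  let ?P = "{1..n-1}"
  let ?L = "\<lambda>x. \<Sum>p\<in>?P. c p * x * b p"
  let ?N = "\<Sum>p\<in>?P. \<Sum>q\<in>?P. \<Sum>r\<in>?P.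
     qtri (c p) (c q) (c r) * d * qtri (b p) (b q) (b r)
     + (3 * qdot (c p) (c q)) *\<^sub>R (qdot (b p) (b q) *\<^sub>R (qcnj (c r) * d * qcnj (b r))
         - (2 * qdot (b p) (b r)) *\<^sub>R (qcnj (c r) * d * qcnj (b q)))"
  note a = assms(3)
  \<comment> \<open>These rules discharge the linearity conditions of the \<open>sum_tensor\<close>
    lemmas.\<close>
  note lin = linearI multilinear_simps algebra_simps
  have L: "?L x = a 0 * x + a 1 * x * qii + a 2 * x * qjj + a 3 * x * qkk" for x
  proof -
    have "?L x = (\<Sum>i\<in>UNIV. a i * x * qbasis i)"
      by (rule sum_tensor[where f = "\<lambda>u v. u * x * v", OF _ _ a]; simp add: lin)
    then show ?thesis by (simp add: sum_4_from_0 qbasis_def)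
  qed
  have matrix: "A *v qcoord x = qcoord (?L x)" for x
    unfolding assms(4) L matrix_vector_mult_add_rdistrib
      qmatrix_mult_qcoord[OF linear_qop] linear_add[OF linear_qcoord]
    by (simp add: qop_def)
  have det: "det A = D"
    unfolding D_def by (rule det_qmatrix_sum) (rule assms(4))
  have solve_iff: "?L x = d \<longleftrightarrow> A *v qcoord x = qcoord d" for x
    unfolding matrix qcoord_inject ..
  have "2 * (\<Sum>p\<in>?P. \<Sum>q\<in>?P. \<Sum>r\<in>?P. \<Sum>s\<in>?P.
               qdot (c p) (c q) * qdot (c r) (c s) * qdot (b p) (b r) * qdot (b q) (b s))
        - (\<Sum>p\<in>?P. \<Sum>q\<in>?P. qdot (c p) (c q) * qdot (b p) (b q))\<^sup>2
        - 1/3 * (\<Sum>p\<in>?P. \<Sum>q\<in>?P. \<Sum>r\<in>?P. \<Sum>s\<in>?P.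
               qdet (c p) (c q) (c r) (c s) * qdet (b p) (b q) (b r) (b s)) = D"
    (is "2 * ?S1 - ?S2\<^sup>2 - 1/3 * ?S3 = D")
  proof -
    \<comment> \<open>In the functions below, the plain arguments receive the \<open>c\<close>
      family and the primed ones the \<open>b\<close> family.\<close>
    have "?S1 = (\<Sum>i\<in>UNIV. \<Sum>j\<in>UNIV. \<Sum>k\<in>UNIV. \<Sum>l\<in>UNIV.
        qdot (a i) (a j) * qdot (a k) (a l) * qdot (qbasis i) (qbasis k) * qdot (qbasis j) (qbasis l))"
      by (rule sum_tensor4[where f = "\<lambda>x x' y y' z z' w w'.
            qdot x y * qdot z w * qdot x' z' * qdot y' w'", OF _ _ _ _ _ _ _ _ a]; simp add: lin)
    moreover have "?S2 = (\<Sum>i\<in>UNIV. \<Sum>j\<in>UNIV. qdot (a i) (a j) * qdot (qbasis i) (qbasis j))"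
      by (rule sum_tensor2[where f = "\<lambda>x x' y y'. qdot x y * qdot x' y'", OF _ _ _ _ a]; simp add: lin)
    moreover have "?S3 = (\<Sum>i\<in>UNIV. \<Sum>j\<in>UNIV. \<Sum>k\<in>UNIV. \<Sum>l\<in>UNIV.
        qdet (a i) (a j) (a k) (a l) * qdet (qbasis i) (qbasis j) (qbasis k) (qbasis l))"
      by (rule sum_tensor4[where f = "\<lambda>x x' y y' z z' w w'. qdet x y z w * qdet x' y' z' w'",
            OF _ _ _ _ _ _ _ _ a]; simp add: lin)
    ultimately show ?thesis
      unfolding D_def by (simp only: qform_eq_sums)
  qed
  moreover have unique: "(\<exists>!x. ?L x = d) \<longleftrightarrow> det A \<noteq> 0"
    unfolding solve_iff ex1_qcoord[of "\<lambda>v. A *v v = qcoord d"] ex1_solution_iff_det ..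
  moreover have "?L x = d \<longleftrightarrow> x = (-1 / (3 * det A)) *\<^sub>R ?N" if "det A \<noteq> 0" for x
  proof -
    have "?N = (\<Sum>i\<in>UNIV. \<Sum>j\<in>UNIV. \<Sum>k\<in>UNIV.
      qtri (a i) (a j) (a k) * d * qtri (qbasis i) (qbasis j) (qbasis k)
      + (3 * qdot (a i) (a j)) *\<^sub>R
          (qdot (qbasis i) (qbasis j) *\<^sub>R (qcnj (a k) * d * qcnj (qbasis k))
           - (2 * qdot (qbasis i) (qbasis k)) *\<^sub>R (qcnj (a k) * d * qcnj (qbasis j))))"
      by (rule sum_tensor3[where f = "\<lambda>x x' y y' z z'. qtri x y z * d * qtri x' y' z'
             + (3 * qdot x y) *\<^sub>R (qdot x' y' *\<^sub>R (qcnj z * d * qcnj z')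
             - (2 * qdot x' z') *\<^sub>R (qcnj z * d * qcnj y'))", OF _ _ _ _ _ _ a]; simp add: lin)
    then have N: "?N = 3 *\<^sub>R qadj (a 0) (a 1) (a 2) (a 3) d"
      by (simp only: sum_qadj)
    \<comment> \<open>The 3 of \<open>sum_qadj\<close> cancels against the denominator, and the sign
      in \<open>qadj_solves\<close> against the leading minus.\<close>
    have "?L ((-1 / (3 * det A)) *\<^sub>R ?N) = (-1 / D) *\<^sub>R ?L (qadj (a 0) (a 1) (a 2) (a 3) d)"
      unfolding N det L by (simp add: scaleR_add_right)
    also have "\<dots> = d"
      using that det unfolding L qadj_solves by (simp add: D_def)
    finally have "?L ((-1 / (3 * det A)) *\<^sub>R ?N) = d" .
    \<comment> \<open>The formula gives one solution; uniqueness for nonzero determinant turns this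
      into the equivalence.\<close>
    moreover have "x = y" if "?L x = d" "?L y = d" for x y
      using that unique \<open>det A \<noteq> 0\<close> by blast
    ultimately show ?thesis by blast
  qed
  ultimately show ?thesis
    unfolding inner_fvec bracket_eq tri_dual_eq using solve_iff det by simp
qed

end
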